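(* Let $G$ be a permutation group of degree $n$ on a finite set $\Omega$. (1) For $1\le k\le n$, the $(k,k)$-universal transversal property for $G$ is equivalent to $k$-homogeneity of $G$, and the $(k,n)$-universal transversal property for $G$ is equivalent to the $k$-universal transversal property for $G$. (2) If $n\ge 2$, the $(2,n)$-universal transversal property for $G$ is equivalent to primitivity of $G$. (3) For fixed $k$, if $G$ possesses the $(k,l)$-universal transversal property, where $1\le k\le l\le n$, then $G$ possesses the $(k,m)$-universal transversal property for all $l\le m\le n$.
   Context: A permutation group of degree $n$ is a subgroup $G$ of the symmetric group on a finite set $\Omega$ with $|\Omega|=n$, acting on the right. A $k$-partition of a set is a partition into $k$ non-empty parts; a transversal for it is a set meeting each part in exactly one point. $G$ is $k$-homogeneous if it is transitive on the $k$-subsets of $\Omega$. $G$ has the $k$-universal transversal property if for every $k$-subset $A$ of $\Omega$ and every $k$-partition $P$ of $\Omega$ there is $g\in G$ such that $Ag$ is a transversal for $P$. For $1\le k\le l\le n$, $G$ has the $(k,l)$-universal transversal property if for every $k$-subset $A$ of $\Omega$, every $l$-subset $B$ of $\Omega$ and every $k$-partition $P$ of $B$ there is $g\in G$ such that $Ag$ is a transversal for $P$. $G$ is primitive if it preserves no partition of $\Omega$ other than the partition into singletons and the partition with one part; in particular, by convention, the trivial group acting on two points is primitive. *)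

theory Defs
  imports "HOL-Algebra.Bij" "HOL-Library.Disjoint_Sets" "HOL-Library.Ramsey"
begin

text \<open>
  The symmetric group on \<open>\<Omega>\<close> is \<^term>\<open>BijGroup \<Omega>\<close>. It composes maps from right to left, while
  permutations acting on the right compose from left to right; a set of permutations is a
  subgroup for one convention iff it is for the other. The image \<open>A g\<close> is \<open>g ` A\<close>.
\<close>
definition permutation_group :: "'a set \<Rightarrow> ('a \<Rightarrow> 'a) set \<Rightarrow> nat \<Rightarrow> bool" where
  "permutation_group \<Omega> G n \<longleftrightarrow> finite \<Omega> \<and> card \<Omega> = n \<and> subgroup G (BijGroup \<Omega>)"

definition k_partition :: "nat \<Rightarrow> 'a set \<Rightarrow> 'a set set \<Rightarrow> bool" where
  "k_partition k S P \<longleftrightarrow> partition_on S P \<and> finite P \<and> card P = k"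

definition transversal :: "'a set set \<Rightarrow> 'a set \<Rightarrow> bool" where
  "transversal P T \<longleftrightarrow> (\<forall>p\<in>P. \<exists>!x. x \<in> T \<inter> p)"

definition homogeneous :: "'a set \<Rightarrow> ('a \<Rightarrow> 'a) set \<Rightarrow> nat \<Rightarrow> bool" where
  "homogeneous \<Omega> G k \<longleftrightarrow> (\<forall>A\<in>nsets \<Omega> k. \<forall>B\<in>nsets \<Omega> k. \<exists>g\<in>G. g ` A = B)"

definition universal_transversal :: "'a set \<Rightarrow> ('a \<Rightarrow> 'a) set \<Rightarrow> nat \<Rightarrow> bool" where
  "universal_transversal \<Omega> G k \<longleftrightarrow>
     (\<forall>A\<in>nsets \<Omega> k. \<forall>P. k_partition k \<Omega> P \<longrightarrow> (\<exists>g\<in>G. transversal P (g ` A)))"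

definition kl_universal_transversal :: "'a set \<Rightarrow> ('a \<Rightarrow> 'a) set \<Rightarrow> nat \<Rightarrow> nat \<Rightarrow> bool" where
  "kl_universal_transversal \<Omega> G k l \<longleftrightarrow>
     (\<forall>A\<in>nsets \<Omega> k. \<forall>B\<in>nsets \<Omega> l. \<forall>P. k_partition k B P \<longrightarrow> (\<exists>g\<in>G. transversal P (g ` A)))"

definition preserves_partition :: "('a \<Rightarrow> 'a) set \<Rightarrow> 'a set set \<Rightarrow> bool" where
  "preserves_partition G P \<longleftrightarrow> (\<forall>g\<in>G. (`) g ` P = P)"

text \<open>Transitivity is not required, so the trivial group on two points is primitive.\<close>
definition primitive :: "'a set \<Rightarrow> ('a \<Rightarrow> 'a) set \<Rightarrow> bool" where
  "primitive \<Omega> G \<longleftrightarrow>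
     (\<forall>P. partition_on \<Omega> P \<and> preserves_partition G P \<longrightarrow> P = (\<lambda>x. {x}) ` \<Omega> \<or> P = {\<Omega>})"

end

theory Submission
  imports Defs
begin

text \<open>
  Two ideas carry the proof.

  The first is a count (\<open>transversal_if_meets_all\<close>): as soon as \<open>k\<close> points meet all of \<open>k\<close>
  disjoint sets, they meet each of them exactly once and none is left over outside these sets. So
  \<open>A g\<close> is a transversal of a \<open>k\<close>-partition iff it meets every part, and it then lies in the set
  that is partitioned. For a \<open>k\<close>-set \<open>B\<close>, whose only \<open>k\<close>-partition is the one into singletons,
  this says \<open>A g = B\<close>, hence \<open>k\<close>-homogeneity. For a \<open>k\<close>-partition of an \<open>m\<close>-set \<open>C\<close> and
  \<open>k \<le> l \<le> m\<close>, the property for \<open>l\<close> applies to the trace of the partition on an \<open>l\<close>-set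
  \<open>B \<subseteq> C\<close> that contains a point of each part, and an image that meets every trace meets every part.

  The second identifies primitivity. If \<open>G\<close> preserves a nontrivial partition and \<open>p\<close> is a part
  with two points \<open>a\<close>, \<open>b\<close>, then no image of \<open>{a, b}\<close> is split by \<open>{p, \<Omega> - p}\<close>, because the image
  lies in one part. Conversely, given a \<open>2\<close>-partition \<open>{X, Y}\<close>, call two points equivalent if every
  element of \<open>G\<close> maps them to the same side. This relation is \<open>G\<close>-invariant and not universal, as
  the identity separates \<open>X\<close> from \<open>Y\<close>. Primitivity therefore makes it the equality relation
  (\<open>separating_element_if_primitive\<close>), so any two distinct points are sent to different sides by
  some element of \<open>G\<close>.
\<close>

section \<open>Counting points against parts\<close>

text \<open>
  Choosing a point of \<open>T\<close> in each member of \<open>P\<close> is injective by disjointness, hence exhausts \<open>T\<close>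
  by cardinality.
\<close>
lemma transversal_if_meets_all:
  assumes "disjoint P" and "finite T" and "card T = card P" and "\<And>p. p \<in> P \<Longrightarrow> T \<inter> p \<noteq> {}"
  shows "transversal P T" and "T \<subseteq> \<Union>P"
proof -
  have "\<forall>p\<in>P. \<exists>x. x \<in> T \<inter> p"
    using assms(4) by blast
  then obtain f where f: "\<And>p. p \<in> P \<Longrightarrow> f p \<in> T \<inter> p"
    unfolding bchoice_iff by blast
  have unique: "p = q" if "p \<in> P" "q \<in> P" "x \<in> p" "x \<in> q" for p q x
    using assms(1) that by (auto dest: disjointD)
  have "inj_on f P"
    using f unique by (metis IntD2 inj_onI)
  then have T: "f ` P = T"
    using f assms(2,3) by (intro card_subset_eq) (auto simp: card_image)
  show "T \<subseteq> \<Union>P"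
    using f T by blast
  show "transversal P T"
    unfolding transversal_def
  proof
    fix p assume p: "p \<in> P"
    show "\<exists>!x. x \<in> T \<inter> p"
    proof (rule ex1I[of _ "f p"])
      show "f p \<in> T \<inter> p" using f p .
    next
      fix x assume x: "x \<in> T \<inter> p"
      then obtain q where "q \<in> P" "x = f q" using T by blast
      then show "x = f p" using unique f p x by (metis IntD2)
    qed
  qed
qed

lemma transversal_meets:
  "transversal P T \<Longrightarrow> p \<in> P \<Longrightarrow> T \<inter> p \<noteq> {}"
  unfolding transversal_def by blast

lemma k_partition_singletons:
  assumes "B \<in> nsets \<Omega> k"
  shows "k_partition k B ((\<lambda>x. {x}) ` B)"
proof -
  have "partition_on B ((\<lambda>x. {x}) ` B)"
    by (rule partition_onI) (auto simp: disjnt_def)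
  then show ?thesis
    using assms by (simp add: k_partition_def nsets_def card_image)
qed

section \<open>Permutations of a finite set\<close>

locale finite_permutation_group =
  fixes \<Omega> :: "'a set" and G :: "('a \<Rightarrow> 'a) set"
  assumes finite: "finite \<Omega>" and subgroup: "subgroup G (BijGroup \<Omega>)"
begin

lemma bij_betw_elem: "g \<in> G \<Longrightarrow> bij_betw g \<Omega> \<Omega>"
  using subgroup.subset[OF subgroup] by (auto simp: BijGroup_def Bij_def)

lemma elem_closed: "g \<in> G \<Longrightarrow> x \<in> \<Omega> \<Longrightarrow> g x \<in> \<Omega>"
  using bij_betw_elem bij_betwE by blast

lemma identity_elem: "(\<lambda>x\<in>\<Omega>. x) \<in> G"
  using subgroup.one_closed[OF subgroup] by (simp add: BijGroup_def)

lemma compose_elem: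
  assumes "g \<in> G" "h \<in> G"
  shows "compose \<Omega> g h \<in> G"
  using subgroup.m_closed[OF subgroup assms] assms subgroup.subset[OF subgroup]
  by (auto simp: BijGroup_def split: if_splits)

lemma inverse_elem:
  assumes "g \<in> G"
  obtains h where "h \<in> G" "\<And>x. x \<in> \<Omega> \<Longrightarrow> h (g x) = x" "\<And>x. x \<in> \<Omega> \<Longrightarrow> g (h x) = x"
proof
  let ?h = "\<lambda>x\<in>\<Omega>. inv_into \<Omega> g x"
  have bij: "g \<in> Bij \<Omega>"
    using assms subgroup.subset[OF subgroup] by (auto simp: BijGroup_def)
  show "?h \<in> G"
    using subgroup.m_inv_closed[OF subgroup assms] by (simp add: inv_BijGroup[OF bij])
  show "?h (g x) = x" if "x \<in> \<Omega>" for x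
    using that bij_betw_elem[OF assms] elem_closed[OF assms]
    by (simp add: bij_betw_def)
  show "g (?h x) = x" if "x \<in> \<Omega>" for x
    using that bij_betw_elem[OF assms] by (simp add: bij_betw_def f_inv_into_f)
qed

lemma image_nsets:
  assumes "g \<in> G" "A \<in> nsets \<Omega> k"
  shows "g ` A \<in> nsets \<Omega> k"
proof -
  have "inj_on g A"
    using assms bij_betw_elem by (auto simp: nsets_def bij_betw_def intro: inj_on_subset)
  then show ?thesis
    using assms elem_closed by (auto simp: nsets_def card_image)
qed

lemma transversal_image_if_meets_all:
  assumes "g \<in> G" "A \<in> nsets \<Omega> k" "k_partition k B P" "\<And>p. p \<in> P \<Longrightarrow> g ` A \<inter> p \<noteq> {}"
  shows "transversal P (g ` A)" and "g ` A \<subseteq> B"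
proof -
  have "disjoint P" "\<Union>P = B" "card P = k"
    using assms(3) by (auto simp: k_partition_def partition_on_def)
  moreover have "finite (g ` A)" "card (g ` A) = k"
    using image_nsets[OF assms(1,2)] by (auto simp: nsets_def)
  ultimately show "transversal P (g ` A)" "g ` A \<subseteq> B"
    using transversal_if_meets_all assms(4) by metis+
qed

section \<open>Homogeneity and partitions of all of \<open>\<Omega>\<close>\<close>

lemma kl_universal_transversal_same_iff:
  "kl_universal_transversal \<Omega> G k k \<longleftrightarrow> homogeneous \<Omega> G k"
proof
  assume kk: "kl_universal_transversal \<Omega> G k k"
  show "homogeneous \<Omega> G k"
    unfolding homogeneous_def
  proof (intro ballI)
    fix A B assume A: "A \<in> nsets \<Omega> k" and B: "B \<in> nsets \<Omega> k"
    let ?P = "(\<lambda>x. {x}) ` B"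
    obtain g where g: "g \<in> G" "transversal ?P (g ` A)"
      using kk A B k_partition_singletons[OF B] unfolding kl_universal_transversal_def by blast
    have "B \<subseteq> g ` A"
      using transversal_meets[OF g(2)] by blast
    moreover have "g ` A \<subseteq> B"
      using transversal_image_if_meets_all(2)[OF g(1) A k_partition_singletons[OF B]]
        transversal_meets[OF g(2)] by blast
    ultimately show "\<exists>g\<in>G. g ` A = B"
      using g(1) by blast
  qed
next
  assume hom: "homogeneous \<Omega> G k"
  show "kl_universal_transversal \<Omega> G k k"
    unfolding kl_universal_transversal_def
  proof (intro ballI allI impI)
    fix A B P assume A: "A \<in> nsets \<Omega> k" and B: "B \<in> nsets \<Omega> k" and P: "k_partition k B P"
    obtain g where g: "g \<in> G" "g ` A = B"
      using hom A B unfolding homogeneous_def by blast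
    have "p \<subseteq> B" and "p \<noteq> {}" if "p \<in> P" for p
      using P that by (auto simp: k_partition_def partition_on_def)
    then have "g ` A \<inter> p \<noteq> {}" if "p \<in> P" for p
      using that unfolding g(2) by (metis inf.absorb_iff2)
    then show "\<exists>g\<in>G. transversal P (g ` A)"
      using transversal_image_if_meets_all(1)[OF g(1) A P] g(1) by blast
  qed
qed

lemma kl_universal_transversal_card_iff:
  "kl_universal_transversal \<Omega> G k (card \<Omega>) \<longleftrightarrow> universal_transversal \<Omega> G k"
proof -
  have "nsets \<Omega> (card \<Omega>) = {\<Omega>}"
    using finite card_subset_eq by (auto simp: nsets_def)
  then show ?thesis
    by (simp add: kl_universal_transversal_def universal_transversal_def)
qed

section \<open>Monotonicity in the size of the partitioned set\<close>

text \<open>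
  The condition \<open>k \<le> l\<close> leaves room in the \<open>l\<close>-set for one point of each part, so that no part
  has an empty trace and the trace has \<open>k\<close> parts again.
\<close>
lemma kl_universal_transversal_mono:
  assumes kl: "kl_universal_transversal \<Omega> G k l" and "k \<le> l" and "l \<le> m"
  shows "kl_universal_transversal \<Omega> G k m"
  unfolding kl_universal_transversal_def
proof (intro ballI allI impI)
  fix A C P assume A: "A \<in> nsets \<Omega> k" and C: "C \<in> nsets \<Omega> m" and P: "k_partition k C P"
  have part: "disjoint P" "\<Union>P = C" "{} \<notin> P" "finite P" "card P = k"
    using P by (auto simp: k_partition_def partition_on_def)
  obtain f where f: "\<And>p. p \<in> P \<Longrightarrow> f p \<in> p"
    using part(3) by (metis ex_in_conv)
  have "f ` P \<subseteq> C" and "card (f ` P) \<le> l" and "l \<le> card C" and "finite C"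
    using f part C \<open>k \<le> l\<close> \<open>l \<le> m\<close> card_image_le[OF part(4), of f] by (auto simp: nsets_def)
  then obtain B where B: "f ` P \<subseteq> B" "B \<subseteq> C" "card B = l"
    using exists_subset_between by metis
  then have "B \<in> nsets \<Omega> l"
    using C by (auto simp: nsets_def intro: finite_subset)
  let ?Q = "(\<lambda>p. p \<inter> B) ` P"
  have nonempty: "f p \<in> p \<inter> B" if "p \<in> P" for p
    using f B(1) that by blast
  have unique: "p = q" if "p \<in> P" "q \<in> P" "x \<in> p" "x \<in> q" for p q x
    using part(1) that by (auto dest: disjointD)
  have "inj_on (\<lambda>p. p \<inter> B) P"
    by (rule inj_onI) (metis IntD1 nonempty unique)
  then have "card ?Q = k"
    using part(5) by (simp add: card_image)
  moreover have "partition_on B ?Q"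
  proof (rule partition_onI)
    show "\<Union>?Q = B" using part(2) B(2) by blast
    show "{} \<notin> ?Q" using nonempty by blast
    show "disjnt q r" if "q \<in> ?Q" "r \<in> ?Q" "q \<noteq> r" for q r
      using that unique unfolding disjnt_def by blast
  qed
  ultimately have "k_partition k B ?Q"
    using part(4) by (simp add: k_partition_def)
  then obtain g where g: "g \<in> G" "transversal ?Q (g ` A)"
    using kl A \<open>B \<in> nsets \<Omega> l\<close> unfolding kl_universal_transversal_def by blast
  have "g ` A \<inter> p \<noteq> {}" if "p \<in> P" for p
    using transversal_meets[OF g(2), of "p \<inter> B"] that by blast
  then show "\<exists>g\<in>G. transversal P (g ` A)"
    using transversal_image_if_meets_all(1)[OF g(1) A P] g(1) by blast
qed

section \<open>Primitivity\<close>

text \<open>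
  Taking parts to parts is enough to permute them: every part is the image of its image under the
  inverse element.
\<close>
lemma preserves_partitionI:
  assumes "partition_on \<Omega> P" and maps: "\<And>g p. g \<in> G \<Longrightarrow> p \<in> P \<Longrightarrow> g ` p \<in> P"
  shows "preserves_partition G P"
  unfolding preserves_partition_def
proof
  fix g assume g: "g \<in> G"
  obtain h where h: "h \<in> G" "\<And>x. x \<in> \<Omega> \<Longrightarrow> g (h x) = x"
    using inverse_elem[OF g] by metis
  have "p \<in> (`) g ` P" if "p \<in> P" for p
  proof -
    have "p \<subseteq> \<Omega>" using assms(1) that by (auto simp: partition_on_def)
    then have "g ` h ` p = p"
      using h(2) by (force simp: image_image)
    then show ?thesis using maps[OF h(1) that] by (metis imageI)
  qed
  then show "(`) g ` P = P"
    using maps[OF g] by blast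
qed

lemma preserves_partition_quotient:
  assumes eq: "equiv \<Omega> R"
    and inv: "\<And>g x y. g \<in> G \<Longrightarrow> (x, y) \<in> R \<Longrightarrow> (g x, g y) \<in> R"
  shows "preserves_partition G (\<Omega> // R)"
proof (rule preserves_partitionI)
  show "partition_on \<Omega> (\<Omega> // R)" using eq by (rule partition_on_quotient)
next
  fix g p assume g: "g \<in> G" and "p \<in> \<Omega> // R"
  then obtain x where x: "x \<in> \<Omega>" "p = R `` {x}" by (auto elim: quotientE)
  obtain h where h: "h \<in> G" "\<And>x. x \<in> \<Omega> \<Longrightarrow> h (g x) = x" "\<And>x. x \<in> \<Omega> \<Longrightarrow> g (h x) = x"
    using inverse_elem[OF g] by metis
  have "g ` (R `` {x}) = R `` {g x}"
  proof
    show "g ` (R `` {x}) \<subseteq> R `` {g x}"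
      using inv[OF g] by blast
    show "R `` {g x} \<subseteq> g ` (R `` {x})"
    proof
      fix y assume y: "y \<in> R `` {g x}"
      then have "y \<in> \<Omega>" using equiv_type[OF eq] by blast
      moreover have "(x, h y) \<in> R" using inv[OF h(1)] y h(2)[OF x(1)] by force
      ultimately show "y \<in> g ` (R `` {x})" using h(3) by (metis Image_singleton_iff imageI)
    qed
  qed
  then show "g ` p \<in> \<Omega> // R"
    using x elem_closed[OF g] by (simp add: quotientI)
qed

text \<open>
  The points that no element of \<open>G\<close> separates with respect to \<open>X\<close> form the classes of a preserved
  partition. Since \<open>X\<close> is a proper nonempty subset, the identity separates some pair, so
  there is more than one class, and primitivity leaves only singletons.
\<close>
lemma separating_element_if_primitive:
  assumes prim: "primitive \<Omega> G" and X: "X \<subseteq> \<Omega>" "X \<noteq> {}" "X \<noteq> \<Omega>"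
    and ab: "a \<in> \<Omega>" "b \<in> \<Omega>" "a \<noteq> b"
  shows "\<exists>g\<in>G. (g a \<in> X) \<noteq> (g b \<in> X)"
proof (rule ccontr)
  assume not_separated: "\<not> ?thesis"
  define R where "R = {(x, y). x \<in> \<Omega> \<and> y \<in> \<Omega> \<and> (\<forall>g\<in>G. g x \<in> X \<longleftrightarrow> g y \<in> X)}"
  have eq: "equiv \<Omega> R"
    by (auto simp: R_def equiv_def refl_on_def sym_on_def trans_on_def)
  have "(g x, g y) \<in> R" if "g \<in> G" "(x, y) \<in> R" for g x y
  proof -
    (* h separates the images under g exactly when the product of g and h separates x and y. *)
    have "h (g x) \<in> X \<longleftrightarrow> h (g y) \<in> X" if "h \<in> G" for h
    proof -
      have "compose \<Omega> h g x \<in> X \<longleftrightarrow> compose \<Omega> h g y \<in> X"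
        using \<open>(x, y) \<in> R\<close> compose_elem[OF that \<open>g \<in> G\<close>] by (simp add: R_def)
      then show ?thesis using \<open>(x, y) \<in> R\<close> by (simp add: R_def compose_eq)
    qed
    then show ?thesis using that elem_closed by (auto simp: R_def)
  qed
  then have "\<Omega> // R = (\<lambda>x. {x}) ` \<Omega> \<or> \<Omega> // R = {\<Omega>}"
    using prim partition_on_quotient[OF eq] preserves_partition_quotient[OF eq]
    unfolding primitive_def by blast
  then show False
  proof
    assume "\<Omega> // R = (\<lambda>x. {x}) ` \<Omega>"
    moreover have "R `` {a} \<in> \<Omega> // R" using ab(1) by (rule quotientI)
    moreover have "a \<in> R `` {a}" "b \<in> R `` {a}"
      using ab not_separated by (auto simp: R_def)
    ultimately show False using ab(3) by auto
  next
    assume one: "\<Omega> // R = {\<Omega>}"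
    obtain x y where xy: "x \<in> X" "y \<in> \<Omega>" "y \<notin> X" using X by blast
    have "R `` {x} = \<Omega>" using one xy X(1) quotientI[of x \<Omega> R] by blast
    then have "(x, y) \<in> R" using xy by blast
    then have "(\<lambda>x\<in>\<Omega>. x) x \<in> X \<longleftrightarrow> (\<lambda>x\<in>\<Omega>. x) y \<in> X"
      using identity_elem unfolding R_def by blast
    then show False using xy X(1) by auto
  qed
qed

lemma universal_transversal_2_iff_primitive:
  "universal_transversal \<Omega> G 2 \<longleftrightarrow> primitive \<Omega> G"
proof
  assume ut: "universal_transversal \<Omega> G 2"
  show "primitive \<Omega> G"
    unfolding primitive_def
  proof (intro allI impI, rule ccontr)
    fix P assume "partition_on \<Omega> P \<and> preserves_partition G P"
      and nontrivial: "\<not> (P = (\<lambda>x. {x}) ` \<Omega> \<or> P = {\<Omega>})"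
    then have P: "partition_on \<Omega> P" and pres: "\<And>g p. g \<in> G \<Longrightarrow> p \<in> P \<Longrightarrow> g ` p \<in> P"
      by (auto simp: preserves_partition_def)
    have unique: "p = q" if "p \<in> P" "q \<in> P" "x \<in> p" "x \<in> q" for p q x
      using P that by (auto simp: partition_on_def dest: disjointD)
    have cover: "\<Union>P = \<Omega>" and nonempty: "{} \<notin> P"
      using P by (auto simp: partition_on_def)
    have "\<exists>p\<in>P. \<nexists>x. p = {x}"
    proof (rule ccontr)
      assume "\<not> ?thesis"
      then have single: "\<exists>x. p = {x}" if "p \<in> P" for p using that by blast
      have "P = (\<lambda>x. {x}) ` \<Omega>"
      proof
        show "P \<subseteq> (\<lambda>x. {x}) ` \<Omega>" using single cover by blast
        show "(\<lambda>x. {x}) ` \<Omega> \<subseteq> P" using single cover by (metis UnionE image_subsetI singletonD)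
      qed
      then show False using nontrivial by blast
    qed
    then obtain p where p: "p \<in> P" "\<nexists>x. p = {x}" by blast
    moreover obtain a where a: "a \<in> p" using nonempty p(1) by (metis ex_in_conv)
    ultimately obtain b where ab: "a \<in> p" "b \<in> p" "a \<noteq> b" by blast
    have sub: "p \<subseteq> \<Omega>" using cover p(1) by blast
    (* Parts of P are disjoint and cover \<Omega>, so p = \<Omega> would be the only part. *)
    have "p \<noteq> \<Omega>"
    proof
      assume "p = \<Omega>"
      have "q = \<Omega>" if q: "q \<in> P" for q
      proof -
        obtain x where "x \<in> q" using nonempty q by (metis ex_in_conv)
        then show ?thesis using unique[OF q p(1)] q cover \<open>p = \<Omega>\<close> by blast
      qed
      then have "P = {\<Omega>}" using p(1) by blast
      then show False using nontrivial by blast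
    qed
    then have part: "k_partition 2 \<Omega> {p, \<Omega> - p}"
      using sub ab(1) by (auto simp: k_partition_def card_2_iff disjnt_def intro!: partition_onI)
    have "{a, b} \<in> nsets \<Omega> 2" using ab sub by (auto simp: nsets_def)
    then obtain g where g: "g \<in> G" "transversal {p, \<Omega> - p} (g ` {a, b})"
      using ut part unfolding universal_transversal_def by blast
    have "g ` {a, b} \<inter> p \<noteq> {}" and outside: "g ` {a, b} \<inter> (\<Omega> - p) \<noteq> {}"
      using transversal_meets[OF g(2)] by blast+
    (* The part g ` p contains both images, one of which lies in p, so the two parts coincide. *)
    then have "g ` p = p"
      using unique[OF pres[OF g(1) p(1)] p(1)] ab(1,2) by blast
    then show False using outside ab(1,2) by blast
  qed
next
  assume prim: "primitive \<Omega> G"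
  show "universal_transversal \<Omega> G 2"
    unfolding universal_transversal_def
  proof (intro ballI allI impI)
    fix A P assume A: "A \<in> nsets \<Omega> 2" and P: "k_partition 2 \<Omega> P"
    obtain a b where ab: "A = {a, b}" "a \<noteq> b" "a \<in> \<Omega>" "b \<in> \<Omega>"
      using A by (auto simp: nsets_def card_2_iff)
    obtain X Y where XY: "P = {X, Y}" "X \<noteq> Y"
      using P by (auto simp: k_partition_def card_2_iff)
    have XY': "X \<union> Y = \<Omega>" "X \<inter> Y = {}" "X \<noteq> {}" "Y \<noteq> {}"
      using P XY by (auto simp: k_partition_def partition_on_def disjoint_def)
    obtain g where g: "g \<in> G" "(g a \<in> X) \<noteq> (g b \<in> X)"
      using separating_element_if_primitive[OF prim _ XY'(3) _ ab(3,4,2)] XY' by blast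
    have "g a \<in> X \<union> Y" "g b \<in> X \<union> Y"
      using elem_closed[OF g(1)] ab XY'(1) by auto
    then have "g ` A \<inter> p \<noteq> {}" if "p \<in> P" for p
      using that g(2) unfolding XY(1) ab(1) by auto
    then show "\<exists>g\<in>G. transversal P (g ` A)"
      using transversal_image_if_meets_all(1)[OF g(1) A P] g(1) by blast
  qed
qed

end

theorem proposition2p1:
  fixes \<Omega> :: "'a set" and G :: "('a \<Rightarrow> 'a) set" and n :: nat
  assumes "permutation_group \<Omega> G n"
  shows "(\<forall>k. 1 \<le> k \<and> k \<le> n \<longrightarrow>
            (kl_universal_transversal \<Omega> G k k \<longleftrightarrow> homogeneous \<Omega> G k) \<and>
            (kl_universal_transversal \<Omega> G k n \<longleftrightarrow> universal_transversal \<Omega> G k))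
       \<and> (n \<ge> 2 \<longrightarrow> (kl_universal_transversal \<Omega> G 2 n \<longleftrightarrow> primitive \<Omega> G))
       \<and> (\<forall>k l. 1 \<le> k \<and> k \<le> l \<and> l \<le> n \<and> kl_universal_transversal \<Omega> G k l \<longrightarrow>
            (\<forall>m. l \<le> m \<and> m \<le> n \<longrightarrow> kl_universal_transversal \<Omega> G k m))"
proof -
  interpret finite_permutation_group \<Omega> G
    using assms by (simp add: finite_permutation_group_def permutation_group_def)
  have "n = card \<Omega>"
    using assms by (simp add: permutation_group_def)
  then show ?thesis
    using kl_universal_transversal_same_iff kl_universal_transversal_card_iff
      universal_transversal_2_iff_primitive kl_universal_transversal_mono by blast
qed

end
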